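(* Let $p$ be an odd prime and $n$ a positive integer. Let $f_0 \in \mathrm{Irr}_p(n)$, and let $\nu_2(p^n-1) = e_0$ and $\nu_2(p^{2n}-1) = e_1$, where $e_0, e_1$ are positive integers with $e_0 < e_1$. Let $\{f_i\}_{i \ge 0}$ be any sequence of polynomials constructed from $f_0$ as follows. If $f_0^R$ is irreducible, then $f_1 := f_0^R$. Otherwise, $f_1$ is one of the two monic irreducible factors of degree $n$ of $f_0^R$, chosen so that $f_1$ has a root which is not $\vartheta_{1/2}$-periodic. For $i \ge 2$, inductively: if $f_{i-1}^R$ is irreducible, then $f_i := f_{i-1}^R$; otherwise, $f_i$ is one of the two monic irreducible factors of $f_{i-1}^R$ of degree $\deg f_{i-1}$ (either choice is allowed). Then there exist two positive integers $s_1, s_2$ such that: (1) $f_0, \dots, f_{s_1-1} \in \mathrm{Irr}_p(n)$; (2) $f_{s_1}, \dots, f_{s_1+s_2-1} \in \mathrm{Irr}_p(2n)$; (3) $f_{s_1+s_2+j} \in \mathrm{Irr}_p(2^{2+j} n)$ for every integer $j \ge 0$; (4) $s_1 \le e_0+1$ and $s_2 = e_1-e_0$.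
   Context: Let $\mathbf{F}_p$ be the field with $p$ elements. For a positive integer $m$, $\mathrm{Irr}_p(m)$ denotes the set of all monic irreducible polynomials of degree $m$ in $\mathbf{F}_p[x]$ different from $x+1$ and $x-1$. For a positive integer $m = 2^e k$ with $k$ odd and $e \ge 0$, $\nu_2(m) = e$. For a monic polynomial $f \in \mathbf{F}_p[x]$ of degree $m$, $f^R$ denotes the monic polynomial of degree $2m$ given by $f^R(x) = (2x)^m \cdot f\left(\frac{1}{2}(x+x^{-1})\right)$. For a finite extension $\mathbf{F}_q$ of $\mathbf{F}_p$, the map $\vartheta_{1/2}$ on $\mathbf{P}^1(\mathbf{F}_q) = \mathbf{F}_q \cup \{\infty\}$ is defined by $\vartheta_{1/2}(x) = \infty$ if $x \in \{0,\infty\}$ and $\vartheta_{1/2}(x) = \frac{1}{2}(x+x^{-1})$ otherwise. An element $x$ is $\vartheta_{1/2}$-periodic if $\vartheta_{1/2}^k(x) = x$ for some positive integer $k$ (where $\vartheta_{1/2}^k$ is the $k$-fold iterate). The construction is meaningful because of the following fact: for $f \in \mathrm{Irr}_p(m)$, either $f^R \in \mathrm{Irr}_p(2m)$, or $f^R$ is the product of two polynomials of $\mathrm{Irr}_p(m)$ which are the minimal polynomials over $\mathbf{F}_p$ of $\alpha$ and $\alpha^{-1}$ for some $\alpha \in \mathbf{F}_{p^m}$, and in the latter case at least one among $\alpha$ and $\alpha^{-1}$ is not $\vartheta_{1/2}$-periodic. *)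

theory Defs
  imports
    "Berlekamp_Zassenhaus.Finite_Field"
    "HOL-Algebra.Algebraic_Closure_Type"
begin

hide_const (open) Divisibility.irreducible Divisibility.prime
  Polynomials.degree Polynomials.lead_coeff Module.smult up_ring.coeff up_ring.monom

definition Irr :: "nat \<Rightarrow> 'a::field poly set" where
  "Irr m = {f. lead_coeff f = 1 \<and> irreducible f \<and> degree f = m \<and> f \<noteq> [:1, 1:] \<and> f \<noteq> [:-1, 1:]}"

text \<open>
  For \<open>m = degree f\<close>, the transform \<open>(2 x)^m * f ((x + 1/x) / 2)\<close>. Since
  \<open>(x + 1/x) / 2 = (x^2 + 1) / (2 x)\<close>, multiplying the \<open>i\<close>-th term by \<open>(2 x)^m\<close> leaves
  \<open>a_i * (2 x)^(m - i) * (x^2 + 1)^i\<close>. The lemma \<open>to_fract_R_transform\<close> is the original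
  identity, in the field of rational functions.
\<close>

definition R_transform :: "'a::field poly \<Rightarrow> 'a poly" where
  "R_transform f = (\<Sum>i\<le>degree f. smult (coeff f i) ([:0, 2:] ^ (degree f - i) * [:1, 0, 1:] ^ i))"

lemma to_fract_power: "to_fract (a ^ n) = to_fract a ^ n"
  by (induction n) simp_all

lemma to_fract_R_transform:
  fixes f :: "'a::field poly"
  assumes two: "(2::'a) \<noteq> 0"
  defines "t \<equiv> to_fract [:0, 1::'a:]"
  shows "to_fract (R_transform f) =
    (2 * t) ^ degree f * poly (map_poly (\<lambda>c. to_fract [:c:]) f) (1 / 2 * (t + 1 / t))"
proof -
  have t0: "t \<noteq> 0"
    by (simp add: t_def)
  have two_eq: "(2::'a poly fract) = to_fract [:2:]"
    by (metis numeral_poly one_add_one to_fract_1 to_fract_add)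
  have two0: "(2::'a poly fract) \<noteq> 0"
    unfolding two_eq using two by simp
  have lin: "to_fract [:0, 2::'a:] = 2 * t"
    unfolding two_eq t_def to_fract_mult[symmetric] by simp
  have "to_fract [:1, 0, 1::'a:] = to_fract (1 + [:0, 1:] * [:0, 1:])"
    by (simp add: one_pCons)
  then have quad: "to_fract [:1, 0, 1::'a:] = 1 + t * t"
    unfolding t_def by (simp only: to_fract_add to_fract_mult to_fract_1)
  have key: "1 + t * t = (2 * t) * (1 / 2 * (t + 1 / t))"
    using t0 two0 by (simp add: field_simps)
  have "to_fract (R_transform f) = (\<Sum>i\<le>degree f. to_fract [:coeff f i:] *
      ((2 * t) ^ (degree f - i) * (1 + t * t) ^ i))"
  proof -
    have "smult c q = [:c:] * q" for c :: 'a and q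
      by simp
    then show ?thesis
      unfolding R_transform_def
      by (simp only: to_fract_sum to_fract_mult to_fract_power lin quad)
  qed
  also have "\<dots> = (\<Sum>i\<le>degree f. (2 * t) ^ degree f *
      (to_fract [:coeff f i:] * (1 / 2 * (t + 1 / t)) ^ i))"
  proof (rule sum.cong[OF refl])
    fix i assume "i \<in> {..degree f}"
    then have "(2 * t) ^ degree f = (2 * t) ^ (degree f - i) * (2 * t) ^ i"
      by (metis atMost_iff le_add_diff_inverse2 power_add)
    then show "to_fract [:coeff f i:] * ((2 * t) ^ (degree f - i) * (1 + t * t) ^ i) =
        (2 * t) ^ degree f * (to_fract [:coeff f i:] * (1 / 2 * (t + 1 / t)) ^ i)"
      unfolding key power_mult_distrib[of "2 * t"] by (simp only: mult_ac)
  qed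
  also have "\<dots> = (2 * t) ^ degree f *
      poly (map_poly (\<lambda>c. to_fract [:c:]) f) (1 / 2 * (t + 1 / t))"
  proof -
    have "degree (map_poly (\<lambda>c. to_fract [:c:]) f) = degree f"
      by (rule degree_map_poly) simp
    then show ?thesis
      by (simp add: poly_altdef coeff_map_poly sum_distrib_left)
  qed
  finally show ?thesis .
qed

datatype 'a P1 = Fin 'a | Infty

text \<open>
  The map is defined on the projective line over any field; below it is used over an algebraic
  closure of the prime field. The projective line over a finite subfield \<open>F\<^sub>q\<close> is stable under it,
  and the restriction is the map of that projective line, so whether a point is periodic does not
  depend on the subfield.
\<close>

fun theta_half :: "'a::field P1 \<Rightarrow> 'a P1" where
  "theta_half Infty = Infty"
| "theta_half (Fin x) = (if x = 0 then Infty else Fin (1 / 2 * (x + inverse x)))"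

definition theta_half_periodic :: "'a::field P1 \<Rightarrow> bool" where
  "theta_half_periodic x \<longleftrightarrow> (\<exists>k>0. (theta_half ^^ k) x = x)"

definition has_nonperiodic_root :: "'a::field poly \<Rightarrow> bool" where
  "has_nonperiodic_root f \<longleftrightarrow>
    (\<exists>\<alpha>::'a alg_closure. poly (map_poly to_ac f) \<alpha> = 0 \<and> \<not> theta_half_periodic (Fin \<alpha>))"

text \<open>Admissible successors of \<open>f\<close>, with no restriction on which factor is taken.\<close>

definition R_step :: "'a::field poly \<Rightarrow> 'a poly \<Rightarrow> bool" where
  "R_step f g \<longleftrightarrow>
    (if irreducible (R_transform f) then g = R_transform f
     else lead_coeff g = 1 \<and> irreducible g \<and> degree g = degree f \<and> g dvd R_transform f)"

definition R_sequence :: "(nat \<Rightarrow> 'a::field poly) \<Rightarrow> bool" where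
  "R_sequence f \<longleftrightarrow>
    R_step (f 0) (f 1) \<and>
    (\<not> irreducible (R_transform (f 0)) \<longrightarrow> has_nonperiodic_root (f 1)) \<and>
    (\<forall>i\<ge>2. R_step (f (i - 1)) (f i))"

end

(* The Cayley map x \<mapsto> (x - 1) / (x + 1) conjugates theta_half to squaring, so its values at successive
   roots of f_i are iterated square roots, and theta_half-periodic points are those whose Cayley
   value has odd order. With p^n - 1 = 2^e0 m and m odd, the m-th powers of the Cayley values have
   order a power of 2, and this order doubles at each step once it is greater than 1, which the
   choice of f_1 forces at the first step. The degree of f_i therefore stays the same as long as
   this order divides p^(deg f_i) - 1, and doubles otherwise. *)
theory Submission
  imports "Berlekamp_Zassenhaus.Distinct_Degree_Factorization" Defs
begin

hide_const (open) comm_monoid_mult_class.coprime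

section \<open>Roots in the algebraic closure\<close>

interpretation to_ac_hom: field_hom "to_ac :: 'a::field \<Rightarrow> 'a alg_closure"
  by unfold_locales auto

interpretation to_ac_poly_hom: map_poly_comm_ring_hom "to_ac :: 'a::field \<Rightarrow> 'a alg_closure" ..

abbreviation ac_eval :: "'a::field poly \<Rightarrow> 'a alg_closure \<Rightarrow> 'a alg_closure" where
  "ac_eval f \<equiv> poly (map_poly to_ac f)"

text \<open>Otherwise \<open>f\<close> and \<open>g\<close> are coprime, and evaluating a Bezout
  identity at the common root gives 0 = 1. This carries a polynomial property of one root of
  \<open>f\<close> to all of its roots.\<close>

lemma irreducible_dvd_if_common_root:
  fixes f g :: "'a::field_gcd poly"
  assumes "irreducible f" "ac_eval f \<alpha> = 0" "ac_eval g \<alpha> = 0"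
  shows "f dvd g"
proof (rule ccontr)
  assume "\<not> f dvd g"
  then have "gcd f g = 1"
    using prime_elem_imp_coprime[OF field_poly_irreducible_imp_prime[OF assms(1)]]
    by (simp add: coprime_iff_gcd_eq_1)
  then obtain u v where "u * f + v * g = 1"
    using bezout_coefficients_fst_snd[of f g] by metis
  then have "ac_eval (u * f + v * g) \<alpha> = 1"
    by simp
  with assms show False
    by (simp add: to_ac_poly_hom.hom_add to_ac_poly_hom.hom_mult)
qed

lemma ac_eval_dvd_root:
  assumes "f dvd g" "ac_eval f \<alpha> = 0"
  shows "ac_eval g \<alpha> = 0"
  using assms by (auto simp: to_ac_poly_hom.hom_mult elim!: dvdE)

lemma ac_root_exists:
  fixes f :: "'a::field poly"
  assumes "irreducible f"
  obtains \<alpha> where "ac_eval f \<alpha> = 0"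
proof -
  from assms have "f \<noteq> 0" "\<not> is_unit f"
    by (auto simp: irreducible_def)
  then have "degree (map_poly to_ac f) > 0"
    by (simp add: is_unit_iff_degree)
  then show thesis
    using that alg_closed_imp_poly_has_root by blast
qed

section \<open>The transform: roots, degree and leading coefficient\<close>

lemma double_mult_half_sum:
  fixes x :: "'a::field"
  assumes "(2::'a) \<noteq> 0" "x \<noteq> 0"
  shows "2 * x * (1 / 2 * (x + inverse x)) = 1 + x * x"
  using assms by (simp add: field_simps)

text \<open>Writing \<open>1 + \<beta> * \<beta>\<close> as \<open>2 * \<beta>\<close> times the
  half sum gives every summand of the transform the common factor
  \<open>(2 * \<beta>) ^ degree f\<close>.\<close>

lemma ac_eval_R_transform:
  fixes f :: "'a::field poly"
  assumes "(2::'a) \<noteq> 0" "\<beta> \<noteq> 0"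
  shows "ac_eval (R_transform f) \<beta> = (2 * \<beta>) ^ degree f * ac_eval f (1 / 2 * (\<beta> + inverse \<beta>))"
proof -
  have two: "(2 :: 'a alg_closure) \<noteq> 0"
    using assms(1) by (metis to_ac_eq_0_iff to_ac_numeral)
  have key: "1 + \<beta> * \<beta> = 2 * \<beta> * (1 / 2 * (\<beta> + inverse \<beta>))"
    using double_mult_half_sum[OF two assms(2)] by (rule sym)
  have lin: "ac_eval [:0, 2:] \<beta> = 2 * \<beta>"
    by (simp add: to_ac_hom.map_poly_pCons_hom)
  have quad: "ac_eval [:1, 0, 1:] \<beta> = 1 + \<beta> * \<beta>"
    by (simp add: to_ac_hom.map_poly_pCons_hom)
  have "ac_eval (R_transform f) \<beta> =
      (\<Sum>i\<le>degree f. to_ac (coeff f i) * ((2 * \<beta>) ^ (degree f - i) * (1 + \<beta> * \<beta>) ^ i))"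
    unfolding R_transform_def
    by (simp add: to_ac_poly_hom.hom_sum to_ac_poly_hom.hom_mult to_ac_poly_hom.hom_power
        poly_sum to_ac_hom.map_poly_hom_smult lin quad del: pCons_one)
  also have "\<dots> = (\<Sum>i\<le>degree f. (2 * \<beta>) ^ degree f *
      (to_ac (coeff f i) * (1 / 2 * (\<beta> + inverse \<beta>)) ^ i))"
  proof (rule sum.cong[OF refl])
    fix i assume "i \<in> {..degree f}"
    then have "(2 * \<beta>) ^ degree f = (2 * \<beta>) ^ (degree f - i) * (2 * \<beta>) ^ i"
      by (metis atMost_iff le_add_diff_inverse2 power_add)
    then show "to_ac (coeff f i) * ((2 * \<beta>) ^ (degree f - i) * (1 + \<beta> * \<beta>) ^ i) =
        (2 * \<beta>) ^ degree f * (to_ac (coeff f i) * (1 / 2 * (\<beta> + inverse \<beta>)) ^ i)"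
      unfolding key power_mult_distrib[of "2 * \<beta>"] by (simp only: mult_ac)
  qed
  finally show ?thesis
    by (simp add: poly_altdef coeff_map_poly sum_distrib_left)
qed

text \<open>At 0 every summand with a positive power of 2x vanishes and only the top one survives.
  Hence 0 is never a root of the transform of a monic polynomial.\<close>

lemma ac_eval_R_transform_0:
  "ac_eval (R_transform f) 0 = to_ac (lead_coeff f)"
proof -
  have "ac_eval (R_transform f) 0 = (\<Sum>i\<le>degree f. to_ac (coeff f i) * 0 ^ (degree f - i))"
    unfolding R_transform_def
    by (simp add: to_ac_poly_hom.hom_sum to_ac_poly_hom.hom_mult to_ac_poly_hom.hom_power
        poly_sum to_ac_hom.map_poly_hom_smult)
  also have "\<dots> = (\<Sum>i\<in>{degree f}. to_ac (coeff f i) * 0 ^ (degree f - i))"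
    by (rule sum.mono_neutral_right) auto
  finally show ?thesis
    by simp
qed

lemma degree_R_transform_summand:
  assumes "i \<le> m"
  shows "degree ([:0, 2::'a::field:] ^ (m - i) * [:1, 0, 1:] ^ i) \<le> m + i"
proof -
  have "degree ([:0, 2::'a:] ^ (m - i)) \<le> (m - i)"
    using degree_power_le[of "[:0, 2::'a:]" "m - i"] by (auto split: if_splits)
  moreover have "degree ([:1, 0, 1::'a:] ^ i) \<le> 2 * i"
    using degree_power_le[of "[:1, 0, 1::'a:]" i] by simp
  ultimately show ?thesis
    using degree_mult_le[of "[:0, 2::'a:] ^ (m - i)" "[:1, 0, 1:] ^ i"] assms by linarith
qed

text \<open>The i-th summand has degree at most \<open>degree f + i\<close>, so only the top one
  reaches \<open>2 * degree f\<close>, and it is a power of the monic x^2 + 1.\<close>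

lemma R_transform_monic:
  fixes f :: "'a::field poly"
  assumes "lead_coeff f = 1"
  shows degree_R_transform: "degree (R_transform f) = 2 * degree f"
    and lead_coeff_R_transform: "lead_coeff (R_transform f) = 1"
proof -
  let ?t = "\<lambda>i. smult (coeff f i) ([:0, 2:] ^ (degree f - i) * [:1, 0, 1:] ^ i)"
  have le: "degree (?t i) \<le> degree f + i" if "i \<le> degree f" for i
    using degree_R_transform_summand[OF that] degree_smult_le le_trans by blast
  then have "degree (?t i) \<le> 2 * degree f" if "i \<le> degree f" for i
    using that le[OF that] by linarith
  then have deg: "degree (R_transform f) \<le> 2 * degree f"
    unfolding R_transform_def by (intro degree_sum_le) auto
  have "coeff (R_transform f) (2 * degree f) = (\<Sum>i\<le>degree f. coeff (?t i) (2 * degree f))"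
    unfolding R_transform_def by (simp add: coeff_sum)
  also have "\<dots> = (\<Sum>i\<in>{degree f}. coeff (?t i) (2 * degree f))"
  proof (rule sum.mono_neutral_right)
    show "\<forall>i\<in>{..degree f} - {degree f}. coeff (?t i) (2 * degree f) = 0"
    proof
      fix i assume "i \<in> {..degree f} - {degree f}"
      then have "degree (?t i) < 2 * degree f"
        using le[of i] by auto
      then show "coeff (?t i) (2 * degree f) = 0"
        by (rule coeff_eq_0)
    qed
  qed auto
  also have "\<dots> = coeff ([:1, 0, 1::'a:] ^ degree f) (2 * degree f)"
    using assms by simp
  also have "\<dots> = 1"
    using lead_coeff_power[of "[:1, 0, 1::'a:]" "degree f"] degree_power_eq[of "[:1, 0, 1::'a:]" "degree f"]
    by (simp add: mult_2 mult_2_right)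
  finally have "coeff (R_transform f) (2 * degree f) = 1" .
  moreover from this have "2 * degree f \<le> degree (R_transform f)"
    by (intro le_degree) simp
  ultimately show "degree (R_transform f) = 2 * degree f" "lead_coeff (R_transform f) = 1"
    using deg by (simp_all add: order_antisym)
qed

lemma R_transform_root:
  fixes f :: "'a::field poly"
  assumes "(2::'a) \<noteq> 0" "lead_coeff f = 1" "ac_eval (R_transform f) \<beta> = 0"
  shows "\<beta> \<noteq> 0" "ac_eval f (1 / 2 * (\<beta> + inverse \<beta>)) = 0"
proof -
  show "\<beta> \<noteq> 0"
    using ac_eval_R_transform_0[of f] assms by auto
  moreover have "(2 :: 'a alg_closure) \<noteq> 0"
    using assms(1) by (metis to_ac_eq_0_iff to_ac_numeral)
  ultimately show "ac_eval f (1 / 2 * (\<beta> + inverse \<beta>)) = 0"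
    using assms(3) ac_eval_R_transform[OF assms(1), of \<beta> f] by simp
qed

section \<open>The Cayley map and periodic points\<close>

definition cayley :: "'a::field \<Rightarrow> 'a" where
  "cayley x = (x - 1) / (x + 1)"

text \<open>The half sum minus 1 and plus 1 are (x - 1)^2 and (x + 1)^2 over the same denominator
  2x, which cancels. At x = -1 both sides are 0, by division by zero.\<close>

lemma cayley_half:
  fixes x :: "'a::field"
  assumes "(2::'a) \<noteq> 0" "x \<noteq> 0"
  shows "cayley (1 / 2 * (x + inverse x)) = cayley x ^ 2"
proof -
  have 1: "1 / 2 * (x + inverse x) - 1 = (x - 1)^2 / (2 * x)"
    using assms by (simp add: field_simps power2_eq_square)
  have 2: "1 / 2 * (x + inverse x) + 1 = (x + 1)^2 / (2 * x)"
    using assms by (simp add: field_simps power2_eq_square)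
  show ?thesis
    unfolding cayley_def 1 2 using assms by (simp add: power_divide)
qed

text \<open>The point -1 is excluded because division by zero makes
  \<open>cayley (-1) = 0 = cayley 1\<close>.\<close>

lemma cayley_inject:
  fixes x y :: "'a::field"
  assumes "(2::'a) \<noteq> 0" "x \<noteq> -1" "y \<noteq> -1"
  shows "cayley x = cayley y \<longleftrightarrow> x = y"
proof
  have nz: "x + 1 \<noteq> 0" "y + 1 \<noteq> 0"
    using assms by (auto simp: add_eq_0_iff2)
  assume "cayley x = cayley y"
  then have "2 * (x - y) = 0"
    using nz by (simp add: cayley_def field_simps)
  with assms(1) show "x = y"
    by simp
qed simp

lemma cayley_neq_1:
  fixes x :: "'a::field"
  assumes "(2::'a) \<noteq> 0"
  shows "cayley x \<noteq> 1"
proof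
  assume "cayley x = 1"
  then have "x + 1 \<noteq> 0" "x - 1 = x + 1"
    by (auto simp: cayley_def divide_eq_1_iff)
  then have "(2::'a) = 0"
    by (simp add: algebra_simps)
  with assms show False ..
qed

text \<open>The value 1 at infinity is the one that \<open>cayley\<close> never takes, so
  injectivity off -1 survives; it also fits \<open>cayley 0 = -1\<close>, whose square is 1, with 0
  being sent to infinity.\<close>

fun P1_cayley :: "'a::field P1 \<Rightarrow> 'a" where
  "P1_cayley Infty = 1"
| "P1_cayley (Fin x) = cayley x"

text \<open>The half sum plus 1 is (x + 1)^2 / (2x), so -1 is its own only preimage. Orbits starting
  elsewhere therefore avoid the exceptional point, which permits iteration.\<close>

lemma P1_cayley_theta_half:
  assumes "(2::'a::field) \<noteq> 0" "z \<noteq> Fin (-1 :: 'a)"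
  shows "theta_half z \<noteq> Fin (-1) \<and> P1_cayley (theta_half z) = P1_cayley z ^ 2"
proof (cases z)
  case (Fin x)
  show ?thesis
  proof (cases "x = 0")
    case True
    then show ?thesis by (simp add: Fin cayley_def)
  next
    case False
    have "1 / 2 * (x + inverse x) + 1 = (x + 1)^2 / (2 * x)"
      using assms False by (simp add: field_simps power2_eq_square)
    moreover have "x + 1 \<noteq> 0"
      using assms Fin by (auto simp: add_eq_0_iff2)
    ultimately have "1 / 2 * (x + inverse x) + 1 \<noteq> 0"
      using assms(1) False by simp
    then have "1 / 2 * (x + inverse x) \<noteq> -1"
      by (metis add.left_inverse)
    then show ?thesis
      using False cayley_half[OF assms(1) False] by (simp add: Fin)
  qed
qed simp

lemma P1_cayley_theta_half_funpow:
  assumes "(2::'a::field) \<noteq> 0" "z \<noteq> Fin (-1 :: 'a)"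
  shows "(theta_half ^^ k) z \<noteq> Fin (-1) \<and> P1_cayley ((theta_half ^^ k) z) = P1_cayley z ^ (2 ^ k)"
proof (induction k)
  case (Suc k)
  then show ?case
    using P1_cayley_theta_half[OF assms(1), of "(theta_half ^^ k) z"]
    by (simp add: power_mult[symmetric] mult.commute)
qed (use assms in simp)

lemma P1_cayley_inject:
  assumes "(2::'a::field) \<noteq> 0" "z \<noteq> Fin (-1 :: 'a)" "z' \<noteq> Fin (-1)" "P1_cayley z = P1_cayley z'"
  shows "z = z'"
  using assms cayley_neq_1[OF assms(1)] cayley_neq_1[OF assms(1), symmetric]
  by (cases z; cases z') (auto simp: cayley_inject[OF assms(1)])

text \<open>By Euler, 2^(totient m) is 1 modulo the odd \<open>m\<close>, so
  \<open>totient m\<close> squarings restore the Cayley value, and injectivity restores the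
  point.\<close>

lemma theta_half_periodic_if_odd_order:
  fixes x :: "'a::field"
  assumes "(2::'a) \<noteq> 0" "x \<noteq> -1" "odd m" "cayley x ^ m = 1"
  shows "theta_half_periodic (Fin x)"
proof -
  from \<open>odd m\<close> have "m > 0" "coprime 2 m"
    by (auto intro: odd_pos)
  then have "[2 ^ totient m = 1] (mod m)"
    by (intro euler_theorem)
  then have "m dvd 2 ^ totient m - 1"
    by (metis cong_to_1_nat)
  then obtain q where "2 ^ totient m - 1 = m * q" ..
  then have q: "2 ^ totient m = Suc (m * q)"
    by (metis One_nat_def Suc_pred pos2 zero_less_power)
  have "cayley x ^ (2 ^ totient m) = cayley x"
    unfolding q by (simp add: power_mult assms(4))
  then have "(theta_half ^^ totient m) (Fin x) = Fin x"
    using P1_cayley_theta_half_funpow[OF assms(1), of "Fin x" "totient m"] assms(1,2)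
    by (intro P1_cayley_inject) auto
  moreover have "totient m > 0"
    using \<open>m > 0\<close> by simp
  ultimately show ?thesis
    unfolding theta_half_periodic_def by blast
qed

section \<open>Frobenius, degrees and Cayley values\<close>

lemma two_neq_0_mod_ring:
  assumes "odd CARD('p::prime_card)"
  shows "(2 :: 'p mod_ring) \<noteq> 0" "(2 :: 'p mod_ring alg_closure) \<noteq> 0"
proof -
  have "\<not> CARD('p) dvd 2"
    using assms prime_card[where 'a = 'p] by (metis even_numeral primes_dvd_imp_eq two_is_prime_nat)
  then have "of_nat 2 \<noteq> (0 :: 'p mod_ring)"
    using of_nat_0_mod_ring_dvd by blast
  then show "(2 :: 'p mod_ring) \<noteq> 0"
    by simp
  then show "(2 :: 'p mod_ring alg_closure) \<noteq> 0"
    by (metis to_ac_eq_0_iff to_ac_numeral)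
qed

text \<open>By \<open>degree_divisor\<close>, \<open>f\<close> divides x^(p^c) - x for c =
  \<open>degree f\<close> and for no smaller positive c; a common root is enough for such a
  divisibility.\<close>

lemma irreducible_root_Frobenius:
  fixes f :: "'p::prime_card mod_ring poly"
  assumes "irreducible f" "ac_eval f \<alpha> = 0"
  shows "\<alpha> ^ (CARD('p) ^ degree f) = \<alpha>"
    and "\<alpha> ^ (CARD('p) ^ c) = \<alpha> \<Longrightarrow> c > 0 \<Longrightarrow> degree f \<le> c"
proof -
  have eval: "ac_eval (monom 1 1 ^ k - monom 1 1) \<alpha> = \<alpha> ^ k - \<alpha>" for k
    by (simp add: to_ac_poly_hom.hom_minus to_ac_poly_hom.hom_power poly_monom)
  show "\<alpha> ^ (CARD('p) ^ degree f) = \<alpha>"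
    using ac_eval_dvd_root[OF degree_divisor(1)[OF assms(1) refl] assms(2)] unfolding eval by simp
  assume "\<alpha> ^ (CARD('p) ^ c) = \<alpha>" "c > 0"
  then have "f dvd monom 1 1 ^ CARD('p) ^ c - monom 1 1"
    by (intro irreducible_dvd_if_common_root[OF assms]) (simp only: eval diff_self)
  then have "\<not> c < degree f"
    using degree_divisor(2)[OF assms(1) refl, of c] \<open>c > 0\<close> by auto
  then show "degree f \<le> c"
    by simp
qed

text \<open>The Cayley map has coefficients in the prime field, so it commutes with Frobenius.
  Injectivity off -1 carries the fixed point condition over, and \<open>\<alpha> \<noteq> 1\<close>
  lets one nonzero factor be cancelled.\<close>

lemma cayley_Frobenius_iff:
  fixes \<alpha> :: "'p::prime_card mod_ring alg_closure"
  assumes "odd CARD('p)" "\<alpha> \<noteq> 1" "\<alpha> \<noteq> -1"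
  shows "\<alpha> ^ (CARD('p) ^ c) = \<alpha> \<longleftrightarrow> cayley \<alpha> ^ (CARD('p) ^ c - 1) = 1"
proof -
  let ?q = "CARD('p) ^ c"
  note two = two_neq_0_mod_ring(2)[OF assms(1)]
  have odd: "odd ?q"
    using assms(1) by simp
  have nz: "\<alpha> + 1 \<noteq> 0" "\<alpha> - 1 \<noteq> 0"
    using assms by (auto simp: add_eq_0_iff2)
  have frob: "(x + y) ^ ?q = x ^ ?q + y ^ ?q" for x y :: "'p mod_ring alg_closure"
    using freshmans_dream'[of ?q c x y] prime_card[where 'a = 'p] by simp
  have "(\<alpha> - 1) ^ ?q = \<alpha> ^ ?q - 1" "(\<alpha> + 1) ^ ?q = \<alpha> ^ ?q + 1"
    using frob[of \<alpha> "-1"] frob[of \<alpha> 1] odd by simp_all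
  then have pow: "cayley \<alpha> ^ ?q = cayley (\<alpha> ^ ?q)"
    by (simp add: cayley_def power_divide)
  have "\<alpha> ^ ?q + 1 \<noteq> 0"
    using \<open>(\<alpha> + 1) ^ ?q = \<alpha> ^ ?q + 1\<close> nz(1) by (metis power_not_zero)
  then have "\<alpha> ^ ?q \<noteq> -1"
    by auto
  then have "\<alpha> ^ ?q = \<alpha> \<longleftrightarrow> cayley \<alpha> ^ ?q = cayley \<alpha>"
    unfolding pow using cayley_inject[OF two _ assms(3)] by blast
  also have "?q = Suc (?q - 1)"
    using odd by (metis Suc_pred' odd_pos diff_Suc_1' One_nat_def)
  then have "cayley \<alpha> ^ ?q = cayley \<alpha> * cayley \<alpha> ^ (?q - 1)"
    by (metis power_Suc)
  moreover have "cayley \<alpha> \<noteq> 0"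
    using nz by (simp add: cayley_def)
  ultimately show ?thesis
    by simp
qed

text \<open>A root 1 or -1 is shared with a linear polynomial, which the irreducible monic
  \<open>f\<close> would then equal; \<open>Irr\<close> excludes both cases.\<close>

lemma Irr_root_neq:
  fixes f :: "'a::field_gcd poly"
  assumes "f \<in> Irr d" "ac_eval f \<alpha> = 0"
  shows "\<alpha> \<noteq> 1" "\<alpha> \<noteq> -1"
proof -
  have aux: "f = [:c, 1:]" if "\<alpha> = - to_ac c" for c
  proof -
    have "ac_eval [:c, 1:] \<alpha> = 0"
      by (simp add: that to_ac_hom.map_poly_pCons_hom)
    moreover have "irreducible f"
      using assms(1) by (simp add: Irr_def)
    ultimately have dvd: "f dvd [:c, 1:]"
      using assms(2) irreducible_dvd_if_common_root by blast
    moreover have "irreducible [:c, 1:]"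
      by (rule irreducible_linear_field_poly) simp
    ultimately have "[:c, 1:] dvd f"
      using assms(1) by (auto simp: Irr_def irreducible_altdef)
    with dvd show ?thesis
      using assms(1) by (intro poly_dvd_antisym) (auto simp: Irr_def)
  qed
  show "\<alpha> \<noteq> 1" "\<alpha> \<noteq> -1"
    using aux[of "-1"] aux[of 1] assms(1) by (auto simp: Irr_def)
qed

section \<open>One step of the construction\<close>

lemma R_step_dvd: "R_step f g \<Longrightarrow> g dvd R_transform f"
  by (auto simp: R_step_def split: if_splits)

lemma R_step_root:
  fixes f :: "'a::field poly"
  assumes "(2::'a) \<noteq> 0" "lead_coeff f = 1" "R_step f g" "ac_eval g \<beta> = 0"
  shows "ac_eval f (1 / 2 * (\<beta> + inverse \<beta>)) = 0"
    and "cayley (1 / 2 * (\<beta> + inverse \<beta>)) = cayley \<beta> ^ 2"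
proof -
  have "(2::'a alg_closure) \<noteq> 0"
    using assms(1) by (metis to_ac_eq_0_iff to_ac_numeral)
  moreover note R_transform_root[OF assms(1,2) ac_eval_dvd_root[OF R_step_dvd[OF assms(3)] assms(4)]]
  ultimately show "ac_eval f (1 / 2 * (\<beta> + inverse \<beta>)) = 0"
    "cayley (1 / 2 * (\<beta> + inverse \<beta>)) = cayley \<beta> ^ 2"
    using cayley_half by blast+
qed

text \<open>The points 1 and -1 are fixed by \<open>theta_half\<close>, so if \<open>g\<close> were
  one of the two excluded linear polynomials, \<open>f\<close> would have the same root.\<close>

lemma R_step_Irr:
  fixes f :: "'a::field_gcd poly"
  assumes "(2::'a) \<noteq> 0" "f \<in> Irr d" "R_step f g"
  shows "g \<in> Irr (if irreducible (R_transform f) then 2 * d else d)"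
proof -
  have two: "(2::'a alg_closure) \<noteq> 0"
    using assms(1) by (metis to_ac_eq_0_iff to_ac_numeral)
  have monic: "lead_coeff f = 1"
    using assms(2) unfolding Irr_def by blast
  note root = R_step_root(1)[OF assms(1) monic assms(3)]
  have "g \<noteq> [:1, 1:]"
  proof
    assume "g = [:1, 1:]"
    then have "ac_eval g (-1) = 0"
      by (simp add: to_ac_hom.map_poly_pCons_hom)
    from Irr_root_neq(2)[OF assms(2) root[OF this]] two show False
      by simp
  qed
  moreover have "g \<noteq> [:-1, 1:]"
  proof
    assume "g = [:-1, 1:]"
    then have "ac_eval g 1 = 0"
      by (simp add: to_ac_hom.map_poly_pCons_hom)
    from Irr_root_neq(1)[OF assms(2) root[OF this]] two show False
      by simp
  qed
  ultimately show ?thesis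
    using assms(2,3) degree_R_transform[OF monic] lead_coeff_R_transform[OF monic]
    by (auto simp: Irr_def R_step_def split: if_splits)
qed

section \<open>Powers of 2 in orders and exponents\<close>

lemma power_eq_1_iff_two_power_dvd:
  fixes w :: "'a::field"
  assumes "(2::'a) \<noteq> 0" "odd m" "m dvd N" "w ^ (m * 2 ^ v) = -1"
    and "N > 0"
  shows "w ^ N = 1 \<longleftrightarrow> 2 ^ Suc v dvd N"
proof
  \<comment> \<open>The order of \<open>w\<close> has 2-part exactly 2^(v+1) and odd part dividing
    \<open>m\<close>; as \<open>m\<close> divides \<open>N\<close>, only the power of 2
    decides.\<close>
  assume "2 ^ Suc v dvd N"
  moreover have "coprime m (2 ^ Suc v)"
    using assms(2) by simp
  ultimately have "m * 2 ^ Suc v dvd N"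
    using assms(3) by (intro divides_mult)
  then obtain k where "N = m * 2 ^ Suc v * k" ..
  then have "N = (m * 2 ^ v) * (2 * k)"
    by simp
  then show "w ^ N = 1"
    using assms(4) by (simp add: power_mult)
next
  assume N: "w ^ N = 1"
  show "2 ^ Suc v dvd N"
  proof (rule ccontr)
    assume not: "\<not> 2 ^ Suc v dvd N"
    define t where "t = multiplicity 2 N"
    obtain q where q: "N = 2 ^ t * q" "odd q"
      using multiplicity_decompose'[of N 2] assms(5) unfolding t_def by auto
    have "t \<le> v"
      using not q(1) by (metis dvd_triv_left dvd_trans le_imp_power_dvd not_less_eq_eq)
    \<comment> \<open>With \<open>q\<close> the odd part of \<open>N\<close>, this multiple of
      \<open>N\<close> makes the \<open>q\<close>-th power of -1 equal to 1, which is impossible for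
      odd \<open>q\<close>.\<close>
    then have "(m * 2 ^ v) * q = N * (m * 2 ^ (v - t))"
      by (simp add: q(1) mult_ac power_add[symmetric])
    then have "(w ^ (m * 2 ^ v)) ^ q = 1"
      using N by (metis power_mult power_one)
    then have "(-1 :: 'a) = 1"
      using assms(4) q(2) by simp
    then have "(2::'a) = 0"
      by (metis add.left_inverse one_add_one)
    with assms(1) show False ..
  qed
qed

text \<open>Doubling the exponent multiplies x - 1 by x + 1, where x is an odd square, so x + 1 is 2
  modulo 4 and adds one factor 2. The exponent starts at 2 because a + 1 itself may be divisible by
  4.\<close>

lemma multiplicity_2_power_minus_1:
  fixes a :: nat
  assumes "odd a" "a > 1"
  shows "multiplicity 2 (a ^ (2 * 2 ^ k) - 1) = multiplicity 2 (a\<^sup>2 - 1) + k"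
proof (induction k)
  case (Suc k)
  define x where "x = a ^ (2 * 2 ^ k)"
  obtain b where b: "a ^ 2 ^ k = 2 * b + 1"
    using assms(1) by (metis oddE even_power)
  have x: "x = (2 * b + 1) ^ 2"
    unfolding x_def b[symmetric] by (simp add: power_mult[symmetric] mult.commute)
  have "x > 1"
    unfolding x_def using assms(2) by (intro one_less_power) auto
  have "x + 1 = 2 * (2 * (b * b + b) + 1)"
    unfolding x by (simp add: power2_eq_square algebra_simps)
  then have "multiplicity 2 (x + 1) = 1"
    by (simp only:) (subst prime_elem_multiplicity_mult_distrib, auto intro: not_dvd_imp_multiplicity_0)
  moreover have "a ^ (2 * 2 ^ Suc k) - 1 = (x - 1) * (x + 1)"
    unfolding x_def by (simp add: algebra_simps power_add[symmetric] mult_2[symmetric])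
  moreover have "multiplicity 2 ((x - 1) * (x + 1)) = multiplicity 2 (x - 1) + multiplicity 2 (x + 1)"
    using \<open>x > 1\<close> by (intro prime_elem_multiplicity_mult_distrib) auto
  ultimately show ?case
    using Suc unfolding x_def[symmetric] by (simp only: add_Suc_right Suc_eq_plus1 add.assoc)
qed simp


section \<open>Cayley values and degrees along a step\<close>

lemma cayley_power_eq_minus_1_all_roots:
  fixes f :: "'a::field_gcd poly"
  assumes "f \<in> Irr d" "ac_eval f \<alpha> = 0" "cayley \<alpha> ^ N = -1" "ac_eval f \<beta> = 0"
  shows "cayley \<beta> ^ N = -1"
proof -
  \<comment> \<open>Clearing denominators turns the condition on the Cayley value into the vanishing
    of a polynomial over the base field, which the irreducible \<open>f\<close> then
    divides.\<close>
  let ?g = "[:-1, 1:] ^ N + [:1, 1:] ^ N :: 'a poly"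
  have eval: "ac_eval ?g x = 0 \<longleftrightarrow> cayley x ^ N = -1" if "ac_eval f x = 0" for x
  proof -
    have "(x + 1) ^ N \<noteq> 0"
      using Irr_root_neq(2)[OF assms(1) that] by (auto simp: add_eq_0_iff2)
    then show ?thesis
      by (simp add: to_ac_poly_hom.hom_add to_ac_poly_hom.hom_power to_ac_hom.map_poly_pCons_hom
          cayley_def power_divide divide_eq_eq add_eq_0_iff2 add.commute)
  qed
  have "f dvd ?g"
    using assms(1) irreducible_dvd_if_common_root[of f \<alpha> ?g] eval[OF assms(2)] assms(2,3)
    unfolding Irr_def by blast
  from ac_eval_dvd_root[OF this assms(4)] show ?thesis
    using eval[OF assms(4)] by blast
qed

lemma R_step_cayley_power:
  fixes f :: "'a::field_gcd poly"
  assumes "(2::'a) \<noteq> 0" "lead_coeff f = 1" "R_step f g"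
    and "\<And>\<alpha>. ac_eval f \<alpha> = 0 \<Longrightarrow> cayley \<alpha> ^ (m * 2 ^ v) = -1"
    and "ac_eval g \<beta> = 0"
  shows "cayley \<beta> ^ (m * 2 ^ Suc v) = -1"
proof -
  note root = R_step_root[OF assms(1,2,3,5)]
  have "cayley \<beta> ^ (2 * (m * 2 ^ v)) = -1"
    using assms(4)[OF root(1)] unfolding root(2) by (simp only: power_mult)
  then show ?thesis
    by (simp add: mult_ac)
qed

lemma R_step_cayley_root:
  fixes f g :: "'p::prime_card mod_ring poly"
  assumes "odd CARD('p)" "f \<in> Irr d" "R_step f g" "ac_eval g \<beta> = 0"
  shows "cayley \<beta> ^ (2 * (CARD('p) ^ d - 1)) = 1"
proof -
  note two = two_neq_0_mod_ring[OF assms(1)]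
  have f: "lead_coeff f = 1" "irreducible f" "degree f = d"
    using assms(2) unfolding Irr_def by blast+
  note root = R_step_root[OF two(1) f(1) assms(3,4)]
  have "cayley (1 / 2 * (\<beta> + inverse \<beta>)) ^ (CARD('p) ^ d - 1) = 1"
    using cayley_Frobenius_iff[OF assms(1) Irr_root_neq[OF assms(2) root(1)]]
      irreducible_root_Frobenius(1)[OF f(2) root(1)] f(3) by blast
  then show ?thesis
    unfolding root(2) by (simp only: power_mult)
qed

text \<open>\<open>R_step\<close> gives \<open>g\<close> degree \<open>2 * d\<close> or
  \<open>d\<close> according to irreducibility of the transform, so this is decided by whether the
  d-th Frobenius power fixes \<open>\<beta>\<close>.\<close>

lemma R_step_irreducible_iff:
  fixes f g :: "'p::prime_card mod_ring poly"
  assumes "odd CARD('p)" "f \<in> Irr d" "R_step f g" "d > 0" "ac_eval g \<beta> = 0"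
  shows "irreducible (R_transform f) \<longleftrightarrow> cayley \<beta> ^ (CARD('p) ^ d - 1) \<noteq> 1"
proof -
  note g = R_step_Irr[OF two_neq_0_mod_ring(1)[OF assms(1)] assms(2,3)]
  note frob = irreducible_root_Frobenius[OF _ assms(5)]
    and iff = cayley_Frobenius_iff[OF assms(1) Irr_root_neq[OF g assms(5)]]
  show ?thesis
  proof (cases "irreducible (R_transform f)")
    case True
    then have "irreducible g" "degree g = 2 * d"
      using g by (auto simp: Irr_def)
    then show ?thesis
      using True frob(2)[of d] assms(4) iff[of d] by auto
  next
    case False
    then have "irreducible g" "degree g = d"
      using g by (auto simp: Irr_def)
    then show ?thesis
      using False frob(1) iff[of d] by auto
  qed
qed

lemma R_step_Irr_degree:
  fixes f g :: "'p::prime_card mod_ring poly"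
  assumes "odd CARD('p)" "f \<in> Irr d" "R_step f g" "d > 0"
    and "odd m" "m dvd CARD('p) ^ d - 1"
    and "\<And>\<beta>. ac_eval g \<beta> = 0 \<Longrightarrow> cayley \<beta> ^ (m * 2 ^ v) = -1"
  shows "g \<in> Irr (if 2 ^ Suc v dvd CARD('p) ^ d - 1 then d else 2 * d)"
proof -
  note two = two_neq_0_mod_ring[OF assms(1)]
  note g = R_step_Irr[OF two(1) assms(2,3)]
  then have "irreducible g"
    by (simp add: Irr_def)
  then obtain \<beta> where \<beta>: "ac_eval g \<beta> = 0"
    by (rule ac_root_exists)
  have "CARD('p) ^ d - 1 > 0"
    using prime_gt_1_nat[OF prime_card[where 'a = 'p]] assms(4) one_less_power zero_less_diff by blast
  from power_eq_1_iff_two_power_dvd[OF two(2) assms(5,6) assms(7)[OF \<beta>] this]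
  have "irreducible (R_transform f) \<longleftrightarrow> \<not> 2 ^ Suc v dvd CARD('p) ^ d - 1"
    using R_step_irreducible_iff[OF assms(1-4) \<beta>] by blast
  with g show ?thesis
    by (cases "irreducible (R_transform f)") simp_all
qed

text \<open>Let z be the m-th power of the Cayley value of a root of \<open>g\<close>. Some root has
  z \<noteq> 1: if the transform is irreducible, even z^(2^e) differs from 1; otherwise a
  nonperiodic root serves, as \<open>m\<close> is odd. Since z^(2^(e+1)) = 1, the order of z is
  2^(a+1) with \<open>a \<le> e\<close>.\<close>

lemma R_sequence_start:
  fixes f g :: "'p::prime_card mod_ring poly"
  assumes "odd CARD('p)" "f \<in> Irr n" "R_step f g" "n > 0"
    and "\<not> irreducible (R_transform f) \<Longrightarrow> has_nonperiodic_root g"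
    and "CARD('p) ^ n - 1 = 2 ^ e * m" "odd m"
  obtains a where "a \<le> e" "\<And>\<beta>. ac_eval g \<beta> = 0 \<Longrightarrow> cayley \<beta> ^ (m * 2 ^ a) = -1"
proof -
  note two = two_neq_0_mod_ring[OF assms(1)]
  note g = R_step_Irr[OF two(1) assms(2,3)]
  have "\<exists>\<beta>. ac_eval g \<beta> = 0 \<and> cayley \<beta> ^ m \<noteq> 1"
  proof (cases "irreducible (R_transform f)")
    case True
    from g have "irreducible g"
      by (simp add: Irr_def)
    then obtain \<beta> where \<beta>: "ac_eval g \<beta> = 0"
      by (rule ac_root_exists)
    have "cayley \<beta> ^ (m * 2 ^ e) \<noteq> 1"
      using R_step_irreducible_iff[OF assms(1-4) \<beta>] True assms(6) by (simp add: mult.commute)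
    then have "cayley \<beta> ^ m \<noteq> 1"
      by (metis power_mult power_one)
    with \<beta> show ?thesis
      by blast
  next
    case False
    then obtain \<beta> where \<beta>: "ac_eval g \<beta> = 0" "\<not> theta_half_periodic (Fin \<beta>)"
      using assms(5) unfolding has_nonperiodic_root_def by blast
    with theta_half_periodic_if_odd_order[OF two(2) Irr_root_neq(2)[OF g \<beta>(1)] assms(7)]
    show ?thesis
      by blast
  qed
  then obtain \<beta> where \<beta>: "ac_eval g \<beta> = 0" "cayley \<beta> ^ m \<noteq> 1"
    by blast
  define z where "z = cayley \<beta> ^ m"
  have "z ^ 2 ^ Suc e = cayley \<beta> ^ (2 * (CARD('p) ^ n - 1))"
    unfolding z_def assms(6) by (simp add: power_mult[symmetric] mult_ac)
  then have "z ^ 2 ^ Suc e = 1" "z ^ 2 ^ 0 \<noteq> 1"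
    using R_step_cayley_root[OF assms(1-3) \<beta>(1)] \<beta>(2) by (simp_all add: z_def)
  \<comment> \<open>Minimality makes \<open>z ^ 2 ^ a\<close> a square root of 1 other than 1, hence
    -1.\<close>
  then obtain a where a: "a < Suc e" "z ^ 2 ^ a \<noteq> 1" "z ^ 2 ^ Suc a = 1"
    using ex_least_nat_less[of "\<lambda>k. z ^ 2 ^ k = 1" "Suc e"] by blast
  then have "(z ^ 2 ^ a)\<^sup>2 = 1"
    by (simp add: power_mult[symmetric] mult.commute)
  with a(2) have "cayley \<beta> ^ (m * 2 ^ a) = -1"
    unfolding z_def by (simp add: power_mult power2_eq_1_iff)
  with a(1) show thesis
    using that[of a] cayley_power_eq_minus_1_all_roots[OF g \<beta>(1)] by simp
qed

section \<open>The degrees of the whole sequence\<close>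

theorem theorem3p1:
  fixes p n e0 e1 :: nat
    and f :: "nat \<Rightarrow> 'p::prime_card mod_ring poly"
  assumes "CARD('p) = p" and "prime p" and "odd p"
    and "n > 0"
    and "f 0 \<in> Irr n"
    and "multiplicity 2 (p ^ n - 1) = e0"
    and "multiplicity 2 (p ^ (2 * n) - 1) = e1"
    and "0 < e0" and "e0 < e1"
    and "R_sequence f"
  shows "\<exists>s1 s2 :: nat. s1 > 0 \<and> s2 > 0 \<and>
    (\<forall>i<s1. f i \<in> Irr n) \<and>
    (\<forall>i. s1 \<le> i \<and> i < s1 + s2 \<longrightarrow> f i \<in> Irr (2 * n)) \<and>
    (\<forall>j. f (s1 + s2 + j) \<in> Irr (2 ^ (2 + j) * n)) \<and>
    s1 \<le> e0 + 1 \<and> s2 = e1 - e0"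
proof -
  have odd: "odd CARD('p)"
    using assms(1,3) by simp
  note two = two_neq_0_mod_ring[OF odd]
  have "p > 1"
    using assms(2) by (rule prime_gt_1_nat)
  then have gt0: "p ^ k - 1 > 0" if "k > 0" for k
    using that one_less_power[of p k] by simp
  obtain m where m: "p ^ n - 1 = 2 ^ e0 * m" "odd m"
    using multiplicity_decompose'[of "p ^ n - 1" 2] gt0[OF assms(4)] assms(6) by auto
  have step: "R_step (f i) (f (Suc i))" for i
    using assms(10) unfolding R_sequence_def
    by (cases i) (auto dest: spec[of _ "Suc i"])
  obtain a where a: "a \<le> e0"
    and f1: "\<And>\<beta>. ac_eval (f 1) \<beta> = 0 \<Longrightarrow> cayley \<beta> ^ (m * 2 ^ a) = -1"
  proof (rule R_sequence_start[OF odd assms(5) _ assms(4) _ _ m(2)])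
    show "R_step (f 0) (f 1)" "\<not> irreducible (R_transform (f 0)) \<Longrightarrow> has_nonperiodic_root (f 1)"
      using assms(10) unfolding R_sequence_def by blast+
    show "CARD('p) ^ n - 1 = 2 ^ e0 * m"
      using m(1) assms(1) by simp
  qed blast
  have monic: "lead_coeff (f i) = 1" for i
  proof -
    have "\<exists>d. f i \<in> Irr d"
      by (induction i) (use assms(5) R_step_Irr[OF two(1) _ step] in blast)+
    then show ?thesis
      unfolding Irr_def by blast
  qed
  \<comment> \<open>The index is shifted: the exponent \<open>a\<close> belongs to
    \<open>f 1\<close>, and nothing is claimed for \<open>f 0\<close>.\<close>
  have roots: "cayley \<beta> ^ (m * 2 ^ (a + i)) = -1" if "ac_eval (f (Suc i)) \<beta> = 0" for i \<beta>
    using that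
  proof (induction i arbitrary: \<beta>)
    case 0
    then show ?case using f1 by simp
  next
    case (Suc i)
    then show ?case
      using R_step_cayley_power[OF two(1) monic step, of "Suc i" m "a + i" \<beta>] by simp
  qed
  have dvd_iff: "2 ^ t dvd p ^ k - 1 \<longleftrightarrow> t \<le> multiplicity 2 (p ^ k - 1)" if "k > 0" for t k
    using gt0[OF that] by (intro power_dvd_iff_le_multiplicity) auto
  have mult: "multiplicity 2 (p ^ (2 ^ Suc k * n) - 1) = e1 + k" for k
  proof -
    have "odd (p ^ n)" "p ^ n > 1"
      using assms(3) one_less_power[OF \<open>p > 1\<close> assms(4)] by simp_all
    from multiplicity_2_power_minus_1[OF this, of k] show ?thesis
      using assms(7) by (simp add: power_mult[symmetric] mult_ac)
  qed
  \<comment> \<open>Degree n persists while a + i \<le> e0. Degree 2n, where the multiplicity is e1,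
    persists while a + i \<le> e1: there the truncated \<open>a + i - e1\<close> is 0. After that
    every step doubles the degree.\<close>
  define D where "D i = (if a + i \<le> e0 then n else 2 ^ Suc (a + i - e1) * n)" for i
  have D: "f i \<in> Irr (D i)" for i
  proof (induction i)
    case 0
    then show ?case
      using assms(5) a by (simp add: D_def)
  next
    case (Suc i)
    have pos: "D i > 0"
      using assms(4) by (simp add: D_def)
    \<comment> \<open>All degrees are multiples of \<open>n\<close>, so the odd part
      \<open>m\<close> found for \<open>n\<close> serves at every step.\<close>
    have "n dvd D i"
      by (simp add: D_def)
    then have "p ^ n - 1 dvd p ^ D i - 1"
      using dvd_power_minus_1_conv2[OF \<open>p > 1\<close> assms(4) _ pos] by blast
    then have "m dvd p ^ D i - 1"
      using m(1) by (metis dvd_trans dvd_triv_right)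
    then have "f (Suc i) \<in> Irr (if 2 ^ Suc (a + i) dvd p ^ D i - 1 then D i else 2 * D i)"
      using R_step_Irr_degree[OF odd Suc.IH step pos m(2) _ roots] assms(1) by blast
    moreover have "(if 2 ^ Suc (a + i) dvd p ^ D i - 1 then D i else 2 * D i) = D (Suc i)"
    proof (cases "a + i \<le> e0")
      case True
      \<comment> \<open>If a + i = e0 the degree doubles to 2n; \<open>e0 < e1\<close> keeps the
        truncated difference at 0.\<close>
      then show ?thesis
        using assms(4,6,9) by (simp only: dvd_iff[OF pos]) (simp add: D_def)
    next
      case False
      \<comment> \<open>This is the maximum of e1 and a + i. It reaches a + i + 1, which preserves
        the degree, exactly when a + i < e1.\<close>
      then have "multiplicity 2 (p ^ D i - 1) = e1 + (a + i - e1)"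
        unfolding D_def using mult by simp
      then show ?thesis
        using False by (simp only: dvd_iff[OF pos]) (auto simp: D_def Suc_diff_le)
    qed
    ultimately show ?case
      by simp
  qed
  show ?thesis
  \<comment> \<open>The witnesses are s1 = e0 - a + 1 and s2 = e1 - e0, the indices being split by a
    + i \<le> e0 and a + i \<le> e1 as in \<open>D\<close>.\<close>
  proof (intro exI conjI allI impI)
    show "f i \<in> Irr n" if "i < e0 - a + 1" for i
    proof -
      have "D i = n"
        using that a by (simp add: D_def)
      with D[of i] show ?thesis by simp
    qed
    show "f i \<in> Irr (2 * n)" if "e0 - a + 1 \<le> i \<and> i < e0 - a + 1 + (e1 - e0)" for i
    proof -
      have "\<not> a + i \<le> e0" "a + i - e1 = 0"
        using that a assms(9) by linarith+
      then have "D i = 2 * n"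
        by (simp add: D_def)
      with D[of i] show ?thesis by simp
    qed
    show "f (e0 - a + 1 + (e1 - e0) + j) \<in> Irr (2 ^ (2 + j) * n)" for j
    proof -
      have "a + (e0 - a + 1 + (e1 - e0) + j) = e1 + Suc j"
        using a assms(9) by simp
      then have "D (e0 - a + 1 + (e1 - e0) + j) = 2 ^ (2 + j) * n"
        using assms(9) by (simp add: D_def)
      with D[of "e0 - a + 1 + (e1 - e0) + j"] show ?thesis by simp
    qed
  qed (use assms(9) in auto)
qed

end
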